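(* For any path $P_n$ of order $n\ge 4$, $\gamma_{tc}(M(P_n))=2n-4$.
   Context: All graphs are finite, simple and undirected. For a graph $H$, a set $D\subseteq V(H)$ is a total dominating set if every vertex of $H$ has a neighbor in $D$. A set $D\subseteq V(H)$ is a total outer-connected dominating set of $H$ if $D$ is a total dominating set and the induced subgraph $H[V(H)\setminus D]$ is connected; $\gamma_{tc}(H)$ denotes the minimum cardinality of a total outer-connected dominating set of $H$. The middle graph $M(G)$ of a graph $G$ has vertex set $V(G)\cup E(G)$, where two elements $x,y$ are adjacent iff either $x,y\in E(G)$ are edges of $G$ sharing an endpoint, or one of them is a vertex of $G$ and the other is an edge of $G$ incident to it. *)

theory Defs
  imports "Graph_Theory.Graph_Theory"
begin

text \<open>
  A finite simple undirected graph is a \<^locale>\<open>pair_graph\<close>: a finite, loop-free, symmetric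
  digraph whose arcs are vertex pairs. Its undirected edge \<open>{u, v}\<close> is represented by the two
  arcs \<open>(u, v)\<close> and \<open>(v, u)\<close>.
\<close>

definition uedges :: "'a pair_pre_digraph \<Rightarrow> 'a set set" where
  "uedges G = {{u, v} | u v. (u, v) \<in> parcs G}"

definition middle_graph :: "'a pair_pre_digraph \<Rightarrow> ('a + 'a set) pair_pre_digraph" where
  "middle_graph G =
    \<lparr> pverts = Inl ` pverts G \<union> Inr ` uedges G,
      parcs = {(Inr e, Inr f) | e f. e \<in> uedges G \<and> f \<in> uedges G \<and> e \<noteq> f \<and> e \<inter> f \<noteq> {}}
        \<union> {(Inl v, Inr e) | v e. v \<in> pverts G \<and> e \<in> uedges G \<and> v \<in> e}
        \<union> {(Inr e, Inl v) | v e. v \<in> pverts G \<and> e \<in> uedges G \<and> v \<in> e} \<rparr>"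

definition total_dominating_set :: "'a pair_pre_digraph \<Rightarrow> 'a set \<Rightarrow> bool" where
  "total_dominating_set H D \<longleftrightarrow>
    D \<subseteq> pverts H \<and> (\<forall>v \<in> pverts H. \<exists>u \<in> D. (v, u) \<in> parcs H)"

text \<open>
  The library's connectedness excludes the graph without vertices, so \<open>D = pverts H\<close> is not a
  total outer-connected dominating set. The qualified name avoids the topological notion.
\<close>

definition total_outer_connected_dominating_set :: "'a pair_pre_digraph \<Rightarrow> 'a set \<Rightarrow> bool" where
  "total_outer_connected_dominating_set H D \<longleftrightarrow>
    total_dominating_set H D \<and> Digraph_Component.connected (with_proj H \<restriction> (pverts H - D))"

definition gamma_tc :: "'a pair_pre_digraph \<Rightarrow> nat" where
  "gamma_tc H = (LEAST k. \<exists>D. total_outer_connected_dominating_set H D \<and> card D = k)"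

definition path_graph :: "nat \<Rightarrow> 'a pair_pre_digraph \<Rightarrow> bool" where
  "path_graph n G \<longleftrightarrow>
    (\<exists>xs. distinct xs \<and> length xs = n \<and> pverts G = set xs \<and>
      parcs G = {(xs ! i, xs ! j) | i j. i < n \<and> j < n \<and> (j = Suc i \<or> i = Suc j)})"

lemma path_graph_imp_pair_graph:
  assumes "path_graph n G"
  shows "pair_graph G"
proof -
  obtain xs where xs: "distinct xs" "length xs = n" "pverts G = set xs"
    and arcs: "parcs G = {(xs ! i, xs ! j) | i j. i < n \<and> j < n \<and> (j = Suc i \<or> i = Suc j)}"
    using assms unfolding path_graph_def by blast
  have sub: "parcs G \<subseteq> set xs \<times> set xs"
    using xs(2) unfolding arcs by auto
  have "finite (parcs G)"
    by (rule finite_subset[OF sub]) simp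
  moreover have "sym (parcs G)"
    unfolding arcs sym_def by blast
  moreover have "fst e \<noteq> snd e" if "e \<in> parcs G" for e
    using that xs(1,2) unfolding arcs by (auto simp: nth_eq_iff_index_eq)
  ultimately show ?thesis
    using sub xs(3) by unfold_locales (auto simp: symmetric_def)
qed

lemma pair_graph_middle_graph:
  assumes "pair_graph G"
  shows "pair_graph (middle_graph G)"
proof -
  interpret pair_graph G by fact
  have "uedges G \<subseteq> (\<lambda>(u, v). {u, v}) ` parcs G"
    by (auto simp: uedges_def)
  then have fin: "finite (uedges G)"
    by (rule finite_subset) simp
  have finv: "finite (pverts (middle_graph G))"
    using fin pair_finite_verts by (simp add: middle_graph_def)
  have sub: "parcs (middle_graph G) \<subseteq> pverts (middle_graph G) \<times> pverts (middle_graph G)"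
    by (auto simp: middle_graph_def)
  have "finite (parcs (middle_graph G))"
    by (rule finite_subset[OF sub]) (simp add: finv)
  moreover have "sym (parcs (middle_graph G))"
    by (auto simp: middle_graph_def sym_def)
  moreover have "fst e \<noteq> snd e" if "e \<in> parcs (middle_graph G)" for e
    using that by (auto simp: middle_graph_def)
  ultimately show ?thesis
    using sub finv by unfold_locales (auto simp: symmetric_def)
qed

end

theory Submission
  imports Defs
begin

text \<open>
  The complement \<open>C\<close> of a total outer-connected dominating set \<open>D\<close> of \<open>M(P\<^sub>n)\<close> has at most three
  elements. A vertex of the path is adjacent in \<open>M(P\<^sub>n)\<close> only to its incident edges, so one of
  these lies in \<open>D\<close>. Hence \<open>C\<close> contains no two consecutive edges, and an edge in \<open>C\<close>
  together with its two end vertices is closed under adjacency within \<open>C\<close>.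
  As \<open>C\<close> is connected, it consists of at most one edge and its ends. Conversely, for \<open>n \<ge> 4\<close>, the
  second edge with its two ends is the complement of a total outer-connected dominating set.
\<close>

text \<open>A walk inside \<open>C\<close> that starts at \<open>x\<close> never leaves
  \<open>S\<close>. The library takes walks in the symmetric closure; symmetry of \<open>H\<close>
  turns each of their steps back into an arc of \<open>H\<close>. This is how connectedness bounds
  the complement from above.\<close>

lemma connected_induced_subset_closed:
  assumes conn: "Digraph_Component.connected (with_proj H \<restriction> C)"
    and sym: "sym (parcs H)"
    and x: "x \<in> C" "x \<in> S"
    and closed: "\<And>u v. \<lbrakk>u \<in> S; u \<in> C; v \<in> C; (u, v) \<in> parcs H\<rbrakk> \<Longrightarrow> v \<in> S"
  shows "C \<subseteq> S"
proof
  fix y assume "y \<in> C"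
  let ?R = "parcs (mk_symmetric (with_proj H \<restriction> C))"
  have "(x, y) \<in> rtrancl_on C ?R"
    using conn x \<open>y \<in> C\<close>
    by (auto simp: Digraph_Component.connected_def strongly_connected_def reachable_def)
  then show "y \<in> S"
  proof (induction rule: rtrancl_on_induct)
    case base
    show ?case by fact
  next
    case (step y z)
    then have "(y, z) \<in> parcs H"
      using sym by (auto simp: parcs_mk_symmetric dest: symD)
    with step closed show ?case by blast
  qed
qed

text \<open>Any two elements are joined through the centre \<open>x\<close>; the arcs back to
  \<open>x\<close> come from \<open>mk_symmetric\<close>.\<close>

lemma connected_induced_star:
  assumes x: "x \<in> C" and star: "\<And>y. \<lbrakk>y \<in> C; y \<noteq> x\<rbrakk> \<Longrightarrow> (x, y) \<in> parcs H"
  shows "Digraph_Component.connected (with_proj H \<restriction> C)"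
proof -
  let ?R = "parcs (mk_symmetric (with_proj H \<restriction> C))"
  have R: "(x, y) \<in> ?R" "(y, x) \<in> ?R" if "y \<in> C" "y \<noteq> x" for y
    using star[OF that] that x by (auto simp: parcs_mk_symmetric intro!: bexI[of _ "(x, y)"])
  have "(u, x) \<in> rtrancl_on C ?R" "(x, u) \<in> rtrancl_on C ?R" if "u \<in> C" for u
    using R[OF that] that x
    by (cases "u = x"; auto intro: rtrancl_on_into_rtrancl_on[OF rtrancl_on_refl])+
  then have "(u, v) \<in> rtrancl_on C ?R" if "u \<in> C" "v \<in> C" for u v
    using that by (blast intro: rtrancl_on_trans)
  then show ?thesis
    using x by (auto simp: Digraph_Component.connected_def strongly_connected_def reachable_def)
qed

text \<open>Fixing the enumeration of the path turns adjacency in the middle graph into arithmetic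
  on indices.\<close>

locale path_enumeration =
  fixes G :: "'a pair_pre_digraph" and n :: nat and xs :: "'a list"
  assumes distinct_xs: "distinct xs" and length_xs: "length xs = n"
    and pverts_G: "pverts G = set xs"
    and parcs_G: "parcs G = {(xs ! i, xs ! j) | i j. i < n \<and> j < n \<and> (j = Suc i \<or> i = Suc j)}"
begin

definition mvert :: "nat \<Rightarrow> 'a + 'a set" where
  "mvert i = Inl (xs ! i)"

text \<open>Only indices with \<open>Suc i < n\<close> denote edges of the path, whence the bounds
  carried by later lemmas.\<close>

definition medge :: "nat \<Rightarrow> 'a + 'a set" where
  "medge i = Inr {xs ! i, xs ! Suc i}"

lemma uedges_G: "uedges G = {{xs ! i, xs ! Suc i} | i. Suc i < n}"
proof (intro equalityI subsetI)
  fix e assume "e \<in> uedges G"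
  then show "e \<in> {{xs ! i, xs ! Suc i} | i. Suc i < n}"
    by (auto simp: uedges_def parcs_G insert_commute)
next
  fix e assume "e \<in> {{xs ! i, xs ! Suc i} | i. Suc i < n}"
  then obtain i where i: "e = {xs ! i, xs ! Suc i}" "Suc i < n" by blast
  have "(xs ! i, xs ! Suc i) \<in> parcs G"
    unfolding parcs_G mem_Collect_eq
    by (rule exI[of _ i], rule exI[of _ "Suc i"]) (use i(2) in simp)
  with i(1) show "e \<in> uedges G" unfolding uedges_def by blast
qed

lemma nth_eq: "\<lbrakk>i < n; j < n\<rbrakk> \<Longrightarrow> xs ! i = xs ! j \<longleftrightarrow> i = j"
  using distinct_xs length_xs nth_eq_iff_index_eq by blast

lemma mvert_eq_iff: "\<lbrakk>i < n; j < n\<rbrakk> \<Longrightarrow> mvert i = mvert j \<longleftrightarrow> i = j"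
  by (simp add: mvert_def nth_eq)

lemma mvert_neq_medge: "mvert i \<noteq> medge j" "medge j \<noteq> mvert i"
  by (simp_all add: mvert_def medge_def)

text \<open>A crosswise match of the end points would force \<open>i = Suc j\<close> and
  \<open>j = Suc i\<close>.\<close>

lemma medge_eq_iff: "\<lbrakk>Suc i < n; Suc j < n\<rbrakk> \<Longrightarrow> medge i = medge j \<longleftrightarrow> i = j"
  by (auto simp: medge_def doubleton_eq_iff nth_eq)

lemma pverts_middle: "pverts (middle_graph G) = mvert ` {..<n} \<union> medge ` {..<n - 1}"
proof -
  have "pverts G = (!) xs ` {..<n}"
    using length_xs by (auto simp: pverts_G in_set_conv_nth)
  moreover have "uedges G = (\<lambda>i. {xs ! i, xs ! Suc i}) ` {..<n - 1}"
    by (auto simp: uedges_G)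
  ultimately show ?thesis
    by (simp add: middle_graph_def image_image mvert_def medge_def)
qed

lemma card_pverts_middle: "card (pverts (middle_graph G)) = n + (n - 1)"
proof -
  have "inj_on mvert {..<n}" "inj_on medge {..<n - 1}"
    by (auto simp: inj_on_def mvert_eq_iff medge_eq_iff)
  moreover have "mvert ` {..<n} \<inter> medge ` {..<n - 1} = {}"
    by (auto simp: mvert_neq_medge)
  ultimately show ?thesis
    by (simp add: pverts_middle card_Un_disjoint card_image)
qed

lemma mvert_mvert_notin: "(mvert i, mvert j) \<notin> parcs (middle_graph G)"
  by (simp add: middle_graph_def mvert_def)

lemma mvert_medge_iff:
  assumes "i < n" "Suc j < n"
  shows "(mvert i, medge j) \<in> parcs (middle_graph G) \<longleftrightarrow> i = j \<or> i = Suc j"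
    and "(medge j, mvert i) \<in> parcs (middle_graph G) \<longleftrightarrow> i = j \<or> i = Suc j"
proof -
  have "{xs ! j, xs ! Suc j} \<in> uedges G" "xs ! i \<in> pverts G"
    using assms length_xs by (auto simp: uedges_G pverts_G)
  then show "(mvert i, medge j) \<in> parcs (middle_graph G) \<longleftrightarrow> i = j \<or> i = Suc j"
    "(medge j, mvert i) \<in> parcs (middle_graph G) \<longleftrightarrow> i = j \<or> i = Suc j"
    using assms by (auto simp: middle_graph_def mvert_def medge_def nth_eq)
qed

lemma medge_medge_iff:
  assumes "Suc i < n" "Suc j < n"
  shows "(medge i, medge j) \<in> parcs (middle_graph G) \<longleftrightarrow> i = Suc j \<or> j = Suc i"
proof -
  have "{xs ! i, xs ! Suc i} \<in> uedges G" "{xs ! j, xs ! Suc j} \<in> uedges G"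
    using assms by (auto simp: uedges_G)
  then show ?thesis
    using assms by (auto simp: middle_graph_def medge_def nth_eq doubleton_eq_iff)
qed

lemma sym_parcs_middle: "sym (parcs (middle_graph G))"
  by (auto simp: middle_graph_def sym_def)

lemma card_complement_le_3:
  assumes tds: "total_dominating_set (middle_graph G) D"
    and conn: "Digraph_Component.connected (with_proj (middle_graph G) \<restriction> C)"
    and C: "C = pverts (middle_graph G) - D"
  shows "card C \<le> 3"
proof (cases "\<exists>k. Suc k < n \<and> medge k \<in> C")
  case True
  then obtain k where k: "Suc k < n" "medge k \<in> C" by blast
  have vertex_dominated: "\<exists>j. Suc j < n \<and> medge j \<notin> C \<and> (i = j \<or> i = Suc j)" if "i < n" for i
  proof -
    have "mvert i \<in> pverts (middle_graph G)"
      using that by (simp add: pverts_middle)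
    with tds obtain u where u: "u \<in> D" "(mvert i, u) \<in> parcs (middle_graph G)"
      unfolding total_dominating_set_def by blast
    with tds have "u \<in> pverts (middle_graph G)"
      by (auto simp: total_dominating_set_def)
    with u(2) obtain j where "u = medge j" "j < n - 1"
      by (auto simp: pverts_middle mvert_mvert_notin)
    with u C that show ?thesis
      by (intro exI[of _ j]) (auto simp: mvert_medge_iff)
  qed
  \<comment> \<open>These two are the only edges at the inner vertex
    \<open>mvert (Suc j)\<close>.\<close>
  have no_two: "\<not> (medge j \<in> C \<and> medge (Suc j) \<in> C)" if "Suc (Suc j) < n" for j
    using vertex_dominated[of "Suc j"] that by auto
  let ?S = "{mvert k, medge k, mvert (Suc k)}"
  have "C \<subseteq> ?S"
  proof (rule connected_induced_subset_closed[OF conn sym_parcs_middle k(2)])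
    fix u v assume uv: "u \<in> ?S" "u \<in> C" "v \<in> C" "(u, v) \<in> parcs (middle_graph G)"
    from uv(3) C consider (V) i where "v = mvert i" "i < n" | (E) j where "v = medge j" "Suc j < n"
      by (auto simp: pverts_middle)
    then show "v \<in> ?S"
    proof cases
      case V
      with uv k show ?thesis by (auto simp: mvert_medge_iff mvert_mvert_notin)
    next
      case E
      \<comment> \<open>An edge next to an element of \<open>?S\<close> is \<open>medge k\<close>
        itself or consecutive to it; \<open>no_two\<close> excludes the latter.\<close>
      then have "j = k \<or> j = Suc k \<or> k = Suc j"
        using uv(1,4) k by (auto simp: mvert_medge_iff medge_medge_iff)
      with no_two[of j] no_two[of k] uv(3) k E show ?thesis by auto
    qed
  qed simp
  then have "card C \<le> card ?S" by (intro card_mono) auto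
  also have "\<dots> \<le> 3" by (simp add: card_insert_if)
  finally show ?thesis .
next
  case False
  then have verts: "C \<subseteq> range mvert"
    by (auto simp: C pverts_middle)
  have "C \<noteq> {}"
    using conn by (auto simp: Digraph_Component.connected_def strongly_connected_def)
  then obtain x where x: "x \<in> C" by blast
  \<comment> \<open>Without edges, \<open>C\<close> consists of path vertices, which are pairwise
    nonadjacent in the middle graph, so \<open>{x}\<close> is already closed.\<close>
  have "C \<subseteq> {x}"
    by (rule connected_induced_subset_closed[OF conn sym_parcs_middle x])
      (use verts mvert_mvert_notin in blast)+
  then have "card C \<le> card {x}" by (intro card_mono) auto
  then show ?thesis by simp
qed

lemma card_total_outer_connected_ge:
  assumes "total_outer_connected_dominating_set (middle_graph G) D"
  shows "2 * n - 4 \<le> card D"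
proof -
  let ?V = "pverts (middle_graph G)"
  have D: "D \<subseteq> ?V" "card (?V - D) \<le> 3"
    using assms card_complement_le_3[of D "?V - D"]
    by (auto simp: total_outer_connected_dominating_set_def total_dominating_set_def)
  have "finite ?V" by (simp add: pverts_middle)
  with D have "card ?V - card D \<le> 3"
    by (metis card_Diff_subset finite_subset)
  then show ?thesis by (simp add: card_pverts_middle)
qed

lemma total_outer_connected_exists:
  assumes "n \<ge> 4"
  shows "\<exists>D. total_outer_connected_dominating_set (middle_graph G) D \<and> card D = 2 * n - 4"
proof -
  let ?V = "pverts (middle_graph G)"
  \<comment> \<open>An end edge of the path is the only neighbour of a leaf and must stay in the
    dominating set. Indices start at 0, and \<open>n \<ge> 4\<close> makes \<open>medge 1\<close> an
    inner edge.\<close>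
  define C where "C = {mvert 1, medge 1, mvert 2}"
  have CV: "C \<subseteq> ?V" using assms by (auto simp: C_def pverts_middle)
  have vert: "mvert i \<in> ?V - C" if "i < n" "i \<noteq> 1" "i \<noteq> 2" for i
    using that assms by (simp add: C_def pverts_middle mvert_eq_iff mvert_neq_medge)
  have edge: "medge j \<in> ?V - C" if "Suc j < n" "j \<noteq> 1" for j
    using that assms by (simp add: C_def pverts_middle medge_eq_iff mvert_neq_medge)
  have "\<exists>u \<in> ?V - C. (v, u) \<in> parcs (middle_graph G)" if v: "v \<in> ?V" for v
  proof -
    from v consider (V) i where "v = mvert i" "i < n" | (E) j where "v = medge j" "Suc j < n"
      by (auto simp: pverts_middle)
    then show ?thesis
    proof cases
      case V
      \<comment> \<open>Chooses an edge at \<open>mvert i\<close> other than \<open>medge 1\<close>.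
        For \<open>i \<ge> 3\<close> it is the preceding edge, which exists even at the last
        vertex.\<close>
      define j where "j = (if i \<le> 1 then 0 else if i = 2 then 2 else i - 1)"
      have "Suc j < n" "j \<noteq> 1" "i = j \<or> i = Suc j"
        using V assms by (auto simp: j_def)
      with V edge show ?thesis by (intro bexI[of _ "medge j"]) (simp_all add: mvert_medge_iff)
    next
      case E
      show ?thesis
      proof (cases "j = 1")
        case True
        \<comment> \<open>Both ends of \<open>medge 1\<close> lie in \<open>C\<close>, so a
          neighbouring edge has to dominate it.\<close>
        with E assms edge[of 0] show ?thesis
          by (intro bexI[of _ "medge 0"]) (simp_all add: medge_medge_iff)
      next
        case False
        \<comment> \<open>Every other edge has an end outside \<open>C\<close>: the left end for
          \<open>j = 0\<close>, the right end for \<open>j \<ge> 2\<close>.\<close>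
        define i where "i = (if j = 0 then 0 else Suc j)"
        have "i < n" "i \<noteq> 1" "i \<noteq> 2" "i = j \<or> i = Suc j"
          using E False by (auto simp: i_def)
        with E vert show ?thesis by (intro bexI[of _ "mvert i"]) (simp_all add: mvert_medge_iff)
      qed
    qed
  qed
  moreover have "Digraph_Component.connected (with_proj (middle_graph G) \<restriction> C)"
    by (rule connected_induced_star[of "medge 1"]) (use assms in \<open>auto simp: C_def mvert_medge_iff\<close>)
  moreover have "?V - (?V - C) = C" using CV by blast
  ultimately have "total_outer_connected_dominating_set (middle_graph G) (?V - C)"
    by (simp add: total_outer_connected_dominating_set_def total_dominating_set_def)
  moreover have "card C = 3"
    using assms by (simp add: C_def mvert_eq_iff mvert_neq_medge)
  then have "card (?V - C) = 2 * n - 4"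
    using CV assms by (simp add: card_Diff_subset finite_subset[OF CV] C_def card_pverts_middle)
  ultimately show ?thesis by blast
qed

end

theorem theorem3p7:
  fixes G :: "'a pair_pre_digraph" and n :: nat
  assumes "n \<ge> 4" and "path_graph n G"
  shows "gamma_tc (middle_graph G) = 2 * n - 4"
proof -
  obtain xs where "path_enumeration G n xs"
    using assms(2) unfolding path_graph_def path_enumeration_def by blast
  then interpret path_enumeration G n xs .
  show ?thesis
    unfolding gamma_tc_def
    by (rule Least_equality)
      (use total_outer_connected_exists[OF assms(1)] card_total_outer_connected_ge in auto)
qed

end
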